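(* Let $r\ge 2$ and $a_1\ge a_2\ge\cdots\ge a_r\ge 3$ be integers, and let $G=C(a_1,a_2,\ldots,a_r)$. Then $\chi_{la}(G)=2$ if and only if either $G=C((4r-2)^{[r-1]},2r-2)$ with $r\ge 3$, or $G=C((2r)^{[(r-1)/2]},(2r-2)^{[(r+1)/2]})$ with $r$ odd. Otherwise, $\chi_{la}(G)=3$.
   Context: A local antimagic labeling of a connected graph $G=(V,E)$ is a bijection $f:E\to\{1,\dots,|E|\}$ such that, with $f^+(u)=\sum f(e)$ (sum over all edges $e$ incident to $u$), one has $f^+(u)\neq f^+(v)$ for every pair of adjacent vertices $u,v$. The color number $c(f)$ is the number of distinct values of $f^+$ on $V$. The local antimagic chromatic number $\chi_{la}(G)$ is the minimum of $c(f)$ over all local antimagic labelings $f$ of $G$. For $r\ge 2$ and $a_1\ge\cdots\ge a_r\ge 3$, $C(a_1,\ldots,a_r)$ is the one-point union of $r$ cycles of orders $a_1,\ldots,a_r$, i.e. the graph obtained from disjoint cycles of these orders by choosing one vertex in each and identifying all chosen vertices into a single vertex. The notation $a^{[n]}$ denotes a sequence of length $n$ all of whose entries equal $a$. *)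

theory Defs
  imports Main "HOL-Library.Extended_Nat"
begin

datatype 'v ugraph = UGraph (verts: "'v set") (edges: "'v set set")

definition simple_graph :: "'v ugraph \<Rightarrow> bool" where
  "simple_graph G \<longleftrightarrow> finite (verts G) \<and> (\<forall>e\<in>edges G. e \<subseteq> verts G \<and> card e = 2)"

definition connected_graph :: "'v ugraph \<Rightarrow> bool" where
  "connected_graph G \<longleftrightarrow> verts G \<noteq> {} \<and>
     (\<forall>u\<in>verts G. \<forall>v\<in>verts G. (u, v) \<in> {(x, y). {x, y} \<in> edges G}\<^sup>*)"

definition graph_iso :: "'v ugraph \<Rightarrow> 'w ugraph \<Rightarrow> bool"  (infix "\<simeq>\<^sub>g" 50) where
  "G \<simeq>\<^sub>g H \<longleftrightarrow> (\<exists>\<phi>. bij_betw \<phi> (verts G) (verts H) \<and> edges H = (\<lambda>e. \<phi> ` e) ` edges G)"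

definition vertex_sum :: "'v ugraph \<Rightarrow> ('v set \<Rightarrow> nat) \<Rightarrow> 'v \<Rightarrow> nat" where
  "vertex_sum G f u = (\<Sum>e | e \<in> edges G \<and> u \<in> e. f e)"

definition local_antimagic_labeling :: "'v ugraph \<Rightarrow> ('v set \<Rightarrow> nat) \<Rightarrow> bool" where
  "local_antimagic_labeling G f \<longleftrightarrow>
     bij_betw f (edges G) {1..card (edges G)} \<and>
     (\<forall>u v. {u, v} \<in> edges G \<longrightarrow> vertex_sum G f u \<noteq> vertex_sum G f v)"

definition color_number :: "'v ugraph \<Rightarrow> ('v set \<Rightarrow> nat) \<Rightarrow> nat" where
  "color_number G f = card (vertex_sum G f ` verts G)"

text \<open>The infimum is taken in \<^typ>\<open>enat\<close>: it is the minimum if \<open>G\<close> has a local antimagic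
  labeling, and \<open>\<infinity>\<close> if it has none.\<close>

definition chi_la :: "'v ugraph \<Rightarrow> enat" where
  "chi_la G = (INF f \<in> {f. local_antimagic_labeling G f}. enat (color_number G f))"

text \<open>This is the cycle of order \<open>n\<close> only for \<open>n \<ge> 3\<close>.\<close>

definition cycle :: "nat \<Rightarrow> nat ugraph" where
  "cycle n = UGraph {..<n} {{j, Suc j mod n} | j. j < n}"

definition disjoint_cycles :: "nat list \<Rightarrow> (nat \<times> nat) ugraph" where
  "disjoint_cycles a = UGraph
     (SIGMA i:{..<length a}. verts (cycle (a ! i)))
     (\<Union>i<length a. (\<lambda>e. Pair i ` e) ` edges (cycle (a ! i)))"

text \<open>The chosen vertex of the \<open>i\<close>-th cycle is \<open>(i, 0)\<close>; all of these are identified, with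
  representative \<open>(0, 0)\<close>.\<close>

definition glue :: "nat \<times> nat \<Rightarrow> nat \<times> nat" where
  "glue v = (if snd v = 0 then (0, 0) else v)"

definition cycle_union :: "nat list \<Rightarrow> (nat \<times> nat) ugraph" where
  "cycle_union a = UGraph
     (glue ` verts (disjoint_cycles a))
     ((\<lambda>e. glue ` e) ` edges (disjoint_cycles a))"

lemma edges_cycle_union:
  "edges (cycle_union a) =
     {{glue (i, j), glue (i, Suc j mod a ! i)} | i j. i < length a \<and> j < a ! i}"
proof -
  have "edges (cycle_union a) =
      (\<Union>i<length a. (\<lambda>e. glue ` Pair i ` e) ` (\<lambda>j. {j, Suc j mod a ! i}) ` {j. j < a ! i})"
    unfolding cycle_union_def disjoint_cycles_def cycle_def
    by (simp add: image_UN image_image setcompr_eq_image)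
  also have "\<dots> = (\<Union>i<length a. (\<lambda>j. {glue (i, j), glue (i, Suc j mod a ! i)}) ` {j. j < a ! i})"
    unfolding image_image by simp
  also have "\<dots> = {{glue (i, j), glue (i, Suc j mod a ! i)} | i j. i < length a \<and> j < a ! i}"
    by blast
  finally show ?thesis .
qed

lemma verts_cycle_union:
  "verts (cycle_union a) = {glue (i, j) | i j. i < length a \<and> j < a ! i}"
  unfolding cycle_union_def disjoint_cycles_def cycle_def by (force simp: image_iff)

lemma simple_graph_cycle_union:
  assumes "\<forall>x\<in>set a. 3 \<le> x"
  shows "simple_graph (cycle_union a)"
proof -
  have "finite (verts (cycle_union a))"
    by (simp add: cycle_union_def disjoint_cycles_def cycle_def)
  moreover have "e \<subseteq> verts (cycle_union a) \<and> card e = 2" if "e \<in> edges (cycle_union a)" for e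
  proof -
    from that obtain i j where e: "e = {glue (i, j), glue (i, Suc j mod a ! i)}"
      and ij: "i < length a" "j < a ! i" unfolding edges_cycle_union by blast
    have a3: "3 \<le> a ! i" using assms ij by auto
    have "glue (i, j) \<noteq> glue (i, Suc j mod a ! i)"
      using a3 ij by (cases "Suc j = a ! i") (auto simp: glue_def)
    moreover have "Suc j mod a ! i < a ! i" using a3 by simp
    ultimately show ?thesis using ij unfolding e verts_cycle_union by fastforce
  qed
  ultimately show ?thesis by (simp add: simple_graph_def)
qed

lemma connected_graph_cycle_union:
  assumes "a \<noteq> []" and "\<forall>x\<in>set a. 3 \<le> x"
  shows "connected_graph (cycle_union a)"
proof -
  let ?R = "{(x, y). {x, y} \<in> edges (cycle_union a)}"
  have sym: "sym ?R" by (auto simp: sym_def insert_commute)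
  have *: "((0, 0), glue (i, j)) \<in> ?R\<^sup>*" if "i < length a" "j < a ! i" for i j
    using that
  proof (induction j)
    case 0
    then show ?case by (simp add: glue_def)
  next
    case (Suc j)
    have "{glue (i, j), glue (i, Suc j)} \<in> edges (cycle_union a)"
      unfolding edges_cycle_union using Suc.prems
      by (intro CollectI exI[of _ i] exI[of _ j]) simp
    then have "(glue (i, j), glue (i, Suc j)) \<in> ?R" by simp
    with Suc show ?case by (meson Suc_lessD rtrancl.rtrancl_into_rtrancl)
  qed
  have 1: "((0, 0), v) \<in> ?R\<^sup>*" if "v \<in> verts (cycle_union a)" for v
    using that * unfolding verts_cycle_union by auto
  have "verts (cycle_union a) \<noteq> {}"
  proof -
    have "0 < length a" "a ! 0 \<in> set a" using assms by simp_all
    then have "0 < length a" "0 < a ! 0" using assms by fastforce+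
    then show ?thesis unfolding verts_cycle_union by blast
  qed
  moreover have "(u, v) \<in> ?R\<^sup>*"
    if "u \<in> verts (cycle_union a)" "v \<in> verts (cycle_union a)" for u v
    using 1[OF that(1)] 1[OF that(2)] sym_rtrancl[OF sym] by (meson rtrancl_trans symD)
  ultimately show ?thesis by (simp add: connected_graph_def)
qed

end

theory Submission
  imports Defs
begin

text \<open>
  Three colors always suffice: label the \<open>m\<close> edges along an Euler tour from the center by
  \<open>1, m, 2, m - 1, \<dots>\<close>. Consecutive labels sum alternately to \<open>m + 1\<close> and \<open>m + 2\<close>, and the center
  gets at least \<open>m + 3\<close>.

  In a 2-coloring all cycles are even; the vertices at odd distance from the center get the color
  \<open>y\<close>, the others \<open>x\<close>. The former cover every edge once, so \<open>y = m + 1\<close>. With \<open>d = x - y\<close>,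
  every second label along a cycle forms an arithmetic progression of difference \<open>d\<close>, and the
  remaining labels are its reflection under \<open>l \<mapsto> m + 1 - l\<close>. Computing the color of the center
  gives \<open>2 (r - 1) (m + 1) = d (m - 2 r + 2)\<close>, hence \<open>d \<ge> 2 r - 1\<close>. The labels \<open>1, \<dots>, d\<close> have
  no predecessor in their progression, so they sit on the \<open>2 r\<close> edges at the center and
  \<open>d \<le> 2 r\<close>. Each of the two values of \<open>d\<close> determines \<open>m\<close> and all cycle lengths.
\<close>

subsection \<open>Invariance under isomorphism\<close>

text \<open>Each edge of \<open>G\<close> takes the label of its image. Simplicity puts all edges
  inside \<open>verts G\<close>, where \<open>\<phi>\<close> is injective.\<close>

lemma labeling_pullback_iso:
  assumes "simple_graph G" "G \<simeq>\<^sub>g H" "local_antimagic_labeling H f"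
  shows "\<exists>g. local_antimagic_labeling G g \<and> color_number G g = color_number H f"
proof -
  from assms(2) obtain \<phi> where bij: "bij_betw \<phi> (verts G) (verts H)"
    and edges: "edges H = (\<lambda>e. \<phi> ` e) ` edges G" unfolding graph_iso_def by blast
  have inj: "inj_on \<phi> (verts G)" and surj: "\<phi> ` verts G = verts H"
    using bij by (auto simp: bij_betw_def)
  have sub: "e \<subseteq> verts G" if "e \<in> edges G" for e
    using assms(1) that by (auto simp: simple_graph_def)
  have inj_e: "inj_on (\<lambda>e. \<phi> ` e) (edges G)"
    using inj sub by (meson inj_on_image_eq_iff inj_onI)
  let ?g = "\<lambda>e. f (\<phi> ` e)"
  have sum: "vertex_sum G ?g u = vertex_sum H f (\<phi> u)" if "u \<in> verts G" for u
  proof -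
    have "{e \<in> edges H. \<phi> u \<in> e} = (\<lambda>e. \<phi> ` e) ` {e \<in> edges G. u \<in> e}"
    proof -
      have "\<phi> u \<in> \<phi> ` e \<longleftrightarrow> u \<in> e" if "e \<in> edges G" for e
        using inj_on_image_mem_iff[OF inj \<open>u \<in> verts G\<close> sub[OF that]] .
      then show ?thesis unfolding edges by blast
    qed
    moreover have "inj_on (\<lambda>e. \<phi> ` e) {e \<in> edges G. u \<in> e}"
      using inj_e by (rule inj_on_subset) auto
    ultimately show ?thesis by (simp add: vertex_sum_def sum.reindex)
  qed
  have card: "card (edges H) = card (edges G)"
    unfolding edges by (rule card_image[OF inj_e])
  have "bij_betw (\<lambda>e. \<phi> ` e) (edges G) (edges H)" using inj_e edges by (simp add: bij_betw_def)
  then have "bij_betw ?g (edges G) {1..card (edges G)}"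
    using assms(3) bij_betw_trans[of "\<lambda>e. \<phi> ` e" "edges G" "edges H" f]
    by (simp add: local_antimagic_labeling_def card o_def)
  moreover have "vertex_sum G ?g u \<noteq> vertex_sum G ?g v" if uv: "{u, v} \<in> edges G" for u v
  proof -
    have "{\<phi> u, \<phi> v} \<in> edges H" unfolding edges using uv
      by (auto intro!: image_eqI[of _ _ "{u, v}"])
    then show ?thesis using sub[OF uv] assms(3) by (auto simp: sum local_antimagic_labeling_def)
  qed
  ultimately have "local_antimagic_labeling G ?g" by (simp add: local_antimagic_labeling_def)
  moreover have "vertex_sum G ?g ` verts G = vertex_sum H f ` verts H"
    unfolding surj[symmetric] image_image by (rule image_cong) (simp_all add: sum)
  ultimately show ?thesis unfolding color_number_def by metis
qed

lemma graph_iso_sym: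
  assumes "simple_graph G" "G \<simeq>\<^sub>g H"
  shows "H \<simeq>\<^sub>g G"
proof -
  from assms(2) obtain \<phi> where bij: "bij_betw \<phi> (verts G) (verts H)"
    and edges: "edges H = (\<lambda>e. \<phi> ` e) ` edges G" unfolding graph_iso_def by blast
  let ?\<psi> = "inv_into (verts G) \<phi>"
  have "?\<psi> ` \<phi> ` e = e" if "e \<in> edges G" for e
    using assms(1) that bij_betw_imp_inj_on[OF bij]
    by (intro inv_into_image_cancel) (auto simp: simple_graph_def)
  then have "(\<lambda>e. ?\<psi> ` e) ` edges H = (\<lambda>e. e) ` edges G"
    unfolding edges image_image by (intro image_cong refl) (simp add: image_image)
  then have "edges G = (\<lambda>e. ?\<psi> ` e) ` edges H" by simp
  then show ?thesis unfolding graph_iso_def using bij_betw_inv_into[OF bij] by blast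
qed

lemma chi_la_iso_le:
  assumes "simple_graph G" "G \<simeq>\<^sub>g H"
  shows "chi_la G \<le> chi_la H"
  unfolding chi_la_def
proof (rule INF_mono)
  fix f assume "f \<in> {f. local_antimagic_labeling H f}"
  then obtain g where "local_antimagic_labeling G g" "color_number G g = color_number H f"
    using labeling_pullback_iso[OF assms] by blast
  then show "\<exists>g\<in>{f. local_antimagic_labeling G f}. enat (color_number G g) \<le> enat (color_number H f)"
    by (intro bexI[of _ g]) simp_all
qed

lemma chi_la_iso:
  assumes "simple_graph G" "simple_graph H" "G \<simeq>\<^sub>g H"
  shows "chi_la G = chi_la H"
  using chi_la_iso_le[OF assms(1,3)] chi_la_iso_le[OF assms(2) graph_iso_sym[OF assms(1,3)]]
    by (rule antisym)

subsection \<open>Labelings in terms of edge indices\<close>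

text \<open>The index \<open>(i, j)\<close> stands for the edge from vertex \<open>j\<close> to its successor on the \<open>i\<close>-th cycle,
  so that the edges at the center are those with \<open>j = 0\<close> and \<open>j = a ! i - 1\<close>.\<close>

definition cu_index :: "nat list \<Rightarrow> (nat \<times> nat) set" where
  "cu_index a = (SIGMA i:{..<length a}. {..<a ! i})"

definition cu_edge :: "nat list \<Rightarrow> nat \<times> nat \<Rightarrow> (nat \<times> nat) set" where
  "cu_edge a p = {glue p, glue (fst p, Suc (snd p) mod a ! fst p)}"

text \<open>Here \<open>p\<close> names a vertex, the one where the edge with index \<open>p\<close>
  starts. The center is named by \<open>(i, 0)\<close> for every cycle \<open>i\<close>.\<close>

definition cu_sum :: "nat list \<Rightarrow> (nat \<times> nat \<Rightarrow> nat) \<Rightarrow> nat \<times> nat \<Rightarrow> nat" where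
  "cu_sum a g p = (if snd p = 0 then \<Sum>i<length a. g (i, 0) + g (i, a ! i - 1)
     else g (fst p, snd p - 1) + g p)"

definition cu_labeling :: "nat list \<Rightarrow> (nat \<times> nat \<Rightarrow> nat) \<Rightarrow> bool" where
  "cu_labeling a g \<longleftrightarrow> bij_betw g (cu_index a) {1..sum_list a} \<and>
     (\<forall>(i, j) \<in> cu_index a. cu_sum a g (i, j) \<noteq> cu_sum a g (i, Suc j mod a ! i))"

lemma Suc_mod_less: "j < n \<Longrightarrow> Suc j mod n = (if Suc j = n then 0 else Suc j)"
  by auto

lemma glue_eq_iff: "glue (i, j) = glue (i', j') \<longleftrightarrow> j = 0 \<and> j' = 0 \<or> i = i' \<and> j = j'"
  by (auto simp: glue_def)

lemma finite_cu_index: "finite (cu_index a)"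
  by (simp add: cu_index_def)

lemma card_cu_index: "card (cu_index a) = sum_list a"
  by (simp add: cu_index_def sum_list_sum_nth atLeast0LessThan)

lemma edges_cu_edge: "edges (cycle_union a) = cu_edge a ` cu_index a"
  unfolding edges_cycle_union cu_edge_def cu_index_def by force

lemma verts_cu_index: "verts (cycle_union a) = glue ` cu_index a"
  unfolding verts_cycle_union cu_index_def by force

text \<open>Orders of at least \<open>3\<close> matter: in a cycle of order \<open>2\<close> both
  edges would be the same vertex set.\<close>

lemma inj_on_cu_edge:
  assumes "\<forall>x\<in>set a. 3 \<le> x"
  shows "inj_on (cu_edge a) (cu_index a)"
proof (rule inj_onI, clarify)
  fix i j i' j'
  assume "(i, j) \<in> cu_index a" "(i', j') \<in> cu_index a"
    and eq: "cu_edge a (i, j) = cu_edge a (i', j')"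
  then have ij: "i < length a" "j < a ! i" "i' < length a" "j' < a ! i'"
    by (auto simp: cu_index_def)
  define n n' where "n = a ! i" and "n' = a ! i'"
  have n: "3 \<le> n" "3 \<le> n'" "j < n" "j' < n'"
    using ij bspec[OF assms nth_mem] by (simp_all add: n_def n'_def)
  define k k' where "k = Suc j mod n" and "k' = Suc j' mod n'"
  then have k: "k = 0 \<and> Suc j = n \<or> k = Suc j" "k' = 0 \<and> Suc j' = n' \<or> k' = Suc j'"
    using n by (simp_all add: Suc_mod_less)
  have "i = i' \<Longrightarrow> n = n'" by (simp add: n_def n'_def)
  moreover have "glue (i, j) = glue (i', j') \<and> glue (i, k) = glue (i', k') \<or>
      glue (i, j) = glue (i', k') \<and> glue (i, k) = glue (i', j')"
    using eq by (simp add: cu_edge_def doubleton_eq_iff n_def n'_def k_def k'_def)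
  ultimately show "i = i' \<and> j = j'" using n k unfolding glue_eq_iff by linarith
qed

lemma vertex_sum_cycle_union:
  assumes "\<forall>x\<in>set a. 3 \<le> x" "p \<in> cu_index a"
  shows "vertex_sum (cycle_union a) f (glue p) = cu_sum a (\<lambda>p. f (cu_edge a p)) p"
proof -
  obtain i j where p: "p = (i, j)" by (cases p)
  with assms have ij: "i < length a" "j < a ! i" and a3: "\<And>i. i < length a \<Longrightarrow> 3 \<le> a ! i"
    by (auto simp: cu_index_def)
  let ?S = "{q \<in> cu_index a. glue p \<in> cu_edge a q}"
  have "{e \<in> edges (cycle_union a). glue p \<in> e} = cu_edge a ` ?S"
    unfolding edges_cu_edge by auto
  moreover have "inj_on (cu_edge a) ?S"
    using inj_on_cu_edge[OF assms(1)] by (rule inj_on_subset) auto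
  ultimately have *: "vertex_sum (cycle_union a) f (glue p) = (\<Sum>q\<in>?S. f (cu_edge a q))"
    by (simp add: vertex_sum_def sum.reindex)
  show ?thesis
  proof (cases "j = 0")
    case True
    \<comment> \<open>The center lies on the first and the last edge of each cycle, which differ
      because the order is at least \<open>3\<close>.\<close>
    have "?S = (\<lambda>i. (i, 0)) ` {..<length a} \<union> (\<lambda>i. (i, a ! i - 1)) ` {..<length a}"
      (is "_ = ?A \<union> ?B")
    proof (intro equalityI subsetI)
      fix q assume "q \<in> ?S"
      then show "q \<in> ?A \<union> ?B" using True a3
        by (cases q) (force simp: p cu_index_def cu_edge_def glue_eq_iff Suc_mod_less split: if_splits)
    next
      fix q assume "q \<in> ?A \<union> ?B"
      then obtain i' where q: "q = (i', 0) \<or> q = (i', a ! i' - 1)" and i': "i' < length a" by auto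
      with a3[OF i'] show "q \<in> ?S" using True
        by (auto simp: p cu_index_def cu_edge_def glue_eq_iff)
    qed
    moreover have "?A \<inter> ?B = {}" using a3 by fastforce
    moreover have "finite ?A" "finite ?B" by simp_all
    ultimately show ?thesis unfolding * using True
      by (simp add: p cu_sum_def sum.union_disjoint sum.reindex inj_on_def sum.distrib)
  next
    case False
    have "?S = {(i, j - 1), (i, j)}"
      using False ij
      by (auto simp: p cu_index_def cu_edge_def glue_eq_iff Suc_mod_less split: if_splits)
    then show ?thesis unfolding * using False by (simp add: p cu_sum_def)
  qed
qed

text \<open>\<open>cu_edge a\<close> is a bijection from indices to edges and turns adjacency into
  succession along a cycle, so labelings can be studied without the graph.\<close>

lemma local_antimagic_labeling_cycle_union_iff:
  assumes "\<forall>x\<in>set a. 3 \<le> x"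
  shows "local_antimagic_labeling (cycle_union a) f \<longleftrightarrow> cu_labeling a (\<lambda>p. f (cu_edge a p))"
    (is "_ \<longleftrightarrow> cu_labeling a ?g")
proof -
  have inj: "inj_on (cu_edge a) (cu_index a)" by (rule inj_on_cu_edge[OF assms])
  have card: "card (edges (cycle_union a)) = sum_list a"
    by (simp add: edges_cu_edge card_image[OF inj] card_cu_index)
  have "bij_betw f (edges (cycle_union a)) {1..sum_list a} \<longleftrightarrow> bij_betw ?g (cu_index a) {1..sum_list a}"
    using bij_betw_comp_iff[of "cu_edge a" "cu_index a" "edges (cycle_union a)" f] inj
    by (simp add: bij_betw_def edges_cu_edge o_def)
  moreover have "(\<forall>u v. {u, v} \<in> edges (cycle_union a) \<longrightarrow>
      vertex_sum (cycle_union a) f u \<noteq> vertex_sum (cycle_union a) f v) \<longleftrightarrow>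
    (\<forall>(i, j) \<in> cu_index a. vertex_sum (cycle_union a) f (glue (i, j)) \<noteq>
      vertex_sum (cycle_union a) f (glue (i, Suc j mod a ! i)))"
  proof (intro iffI allI impI ballI; clarify?)
    fix i j
    assume *: "\<forall>u v. {u, v} \<in> edges (cycle_union a) \<longrightarrow>
      vertex_sum (cycle_union a) f u \<noteq> vertex_sum (cycle_union a) f v" "(i, j) \<in> cu_index a"
      "vertex_sum (cycle_union a) f (glue (i, j)) =
      vertex_sum (cycle_union a) f (glue (i, Suc j mod a ! i))"
    have "cu_edge a (i, j) \<in> edges (cycle_union a)" using *(2) by (simp add: edges_cu_edge)
    with * show False unfolding cu_edge_def fst_conv snd_conv by blast
  next
    fix u v
    assume *: "\<forall>(i, j) \<in> cu_index a. vertex_sum (cycle_union a) f (glue (i, j)) \<noteq>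
      vertex_sum (cycle_union a) f (glue (i, Suc j mod a ! i))"
      "vertex_sum (cycle_union a) f u = vertex_sum (cycle_union a) f v"
      "{u, v} \<in> edges (cycle_union a)"
    from *(3) obtain i j where ij: "(i, j) \<in> cu_index a" and "{u, v} = cu_edge a (i, j)"
      unfolding edges_cu_edge by auto
    then have "u = glue (i, j) \<and> v = glue (i, Suc j mod a ! i) \<or>
      v = glue (i, j) \<and> u = glue (i, Suc j mod a ! i)"
      by (auto simp: cu_edge_def doubleton_eq_iff)
    with *(2) bspec[OF *(1) ij] show False by auto
  qed
  moreover have "(i, Suc j mod a ! i) \<in> cu_index a" if "(i, j) \<in> cu_index a" for i j
    using that by (auto simp: cu_index_def)
  then have "(\<forall>(i, j) \<in> cu_index a. vertex_sum (cycle_union a) f (glue (i, j)) \<noteq>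
      vertex_sum (cycle_union a) f (glue (i, Suc j mod a ! i))) \<longleftrightarrow>
    (\<forall>(i, j) \<in> cu_index a. cu_sum a ?g (i, j) \<noteq> cu_sum a ?g (i, Suc j mod a ! i))"
    by (intro ball_cong refl) (auto simp: vertex_sum_cycle_union[OF assms])
  ultimately show ?thesis
    unfolding local_antimagic_labeling_def cu_labeling_def card by argo
qed

lemma color_number_cycle_union:
  assumes "\<forall>x\<in>set a. 3 \<le> x"
  shows "color_number (cycle_union a) f = card (cu_sum a (\<lambda>p. f (cu_edge a p)) ` cu_index a)"
  unfolding color_number_def verts_cu_index image_image
  by (rule arg_cong[where f = card], rule image_cong)
    (simp_all add: vertex_sum_cycle_union[OF assms])

lemma cu_sum_cong:
  assumes "\<And>q. q \<in> cu_index a \<Longrightarrow> g q = h q" "\<forall>x\<in>set a. 3 \<le> x" "p \<in> cu_index a"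
  shows "cu_sum a g p = cu_sum a h p"
proof -
  have "(i, 0) \<in> cu_index a \<and> (i, a ! i - 1) \<in> cu_index a" if "i < length a" for i
    using bspec[OF assms(2) nth_mem[OF that]] that by (simp add: cu_index_def)
  moreover have "(fst p, snd p - 1) \<in> cu_index a" using assms(3) by (auto simp: cu_index_def)
  ultimately show ?thesis using assms(1,3) by (simp add: cu_sum_def)
qed

text \<open>The way back from indices to edges, by inverting \<open>cu_edge a\<close>. The two
  labelings agree only on \<open>cu_index a\<close>, and by \<open>cu_sum_cong\<close> the sums look
  no further.\<close>

lemma cu_labeling_realize:
  assumes "\<forall>x\<in>set a. 3 \<le> x" "cu_labeling a g"
  shows "\<exists>f. local_antimagic_labeling (cycle_union a) f \<and>
    color_number (cycle_union a) f = card (cu_sum a g ` cu_index a)"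
proof -
  let ?f = "\<lambda>e. g (inv_into (cu_index a) (cu_edge a) e)"
  have eq: "?f (cu_edge a p) = g p" if "p \<in> cu_index a" for p
    using inj_on_cu_edge[OF assms(1)] that by simp
  have sum: "cu_sum a (\<lambda>p. ?f (cu_edge a p)) p = cu_sum a g p" if "p \<in> cu_index a" for p
    by (rule cu_sum_cong[OF eq assms(1) that])
  have "(i, Suc j mod a ! i) \<in> cu_index a" if "(i, j) \<in> cu_index a" for i j
    using that by (auto simp: cu_index_def)
  then have "cu_labeling a (\<lambda>p. ?f (cu_edge a p))"
    using assms(2) bij_betw_cong[of "cu_index a" "\<lambda>p. ?f (cu_edge a p)" g, OF eq]
    by (auto simp: cu_labeling_def sum)
  moreover have "cu_sum a (\<lambda>p. ?f (cu_edge a p)) ` cu_index a = cu_sum a g ` cu_index a"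
    by (rule image_cong) (simp_all add: sum)
  ultimately show ?thesis
    by (intro exI[of _ ?f])
      (simp add: local_antimagic_labeling_cycle_union_iff[OF assms(1)]
        color_number_cycle_union[OF assms(1)])
qed

subsection \<open>Three colors\<close>

lemma bij_betw_if_inj_into:
  assumes "finite B" "card A = card B" "inj_on g A" "g ` A \<subseteq> B"
  shows "bij_betw g A B"
  using assms card_subset_eq[of B "g ` A"] by (simp add: bij_betw_def card_image)

lemma bij_betw_if_surj:
  assumes "finite A" "card A = card B" "B \<subseteq> g ` A"
  shows "bij_betw g A B"
proof -
  have "card (g ` A) \<le> card B" using assms(1,2) by (metis card_image_le)
  then have "B = g ` A" using assms by (intro card_seteq) auto
  then show ?thesis using assms by (simp add: bij_betw_def eq_card_imp_inj_on)
qed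

lemma sum_list_take_mono:
  fixes a :: "nat list"
  assumes "i \<le> j"
  shows "sum_list (take i a) \<le> sum_list (take j a)"
  using take_add[of i "j - i" a] assms by simp

text \<open>Position, counted from \<open>0\<close>, on the Euler tour that runs through the cycles
  one after another, each from the center back to it.\<close>

definition tour_pos :: "nat list \<Rightarrow> nat \<times> nat \<Rightarrow> nat" where
  "tour_pos a p = sum_list (take (fst p) a) + snd p"

lemma tour_pos_less:
  assumes "(i, j) \<in> cu_index a" "i < i'"
  shows "tour_pos a (i, j) < sum_list (take i' a)"
proof -
  have "tour_pos a (i, j) < sum_list (take (Suc i) a)"
    using assms(1) by (simp add: tour_pos_def cu_index_def take_Suc_conv_app_nth)
  also have "\<dots> \<le> sum_list (take i' a)" using assms(2) by (simp add: sum_list_take_mono)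
  finally show ?thesis .
qed

lemma tour_pos_less_sum_list:
  assumes "(i, j) \<in> cu_index a"
  shows "tour_pos a (i, j) < sum_list a"
proof -
  have "i < length a" using assms by (simp add: cu_index_def)
  from tour_pos_less[OF assms this] show ?thesis by simp
qed

lemma bij_betw_tour_pos: "bij_betw (tour_pos a) (cu_index a) {..<sum_list a}"
proof (rule bij_betw_if_inj_into)
  show "inj_on (tour_pos a) (cu_index a)"
  proof (rule inj_onI, clarify)
    fix i j i' j'
    assume *:
      "(i, j) \<in> cu_index a" "(i', j') \<in> cu_index a" "tour_pos a (i, j) = tour_pos a (i', j')"
    have "\<not> i < i'" "\<not> i' < i"
      using tour_pos_less[OF *(1), of i'] tour_pos_less[OF *(2), of i] *(3)
      by (auto simp: tour_pos_def)
    then have "i = i'" by simp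
    then show "i = i' \<and> j = j'" using *(3) by (simp add: tour_pos_def)
  qed
qed (auto simp: card_cu_index tour_pos_less_sum_list)

text \<open>The sequence \<open>1, m, 2, m - 1, ...\<close>, indexed from \<open>0\<close>.\<close>

definition zigzag :: "nat \<Rightarrow> nat \<Rightarrow> nat" where
  "zigzag m t = (if even t then t div 2 + 1 else m - t div 2)"

lemma bij_betw_zigzag: "bij_betw (zigzag m) {..<m} {1..m}"
proof (rule bij_betw_if_inj_into)
  show "inj_on (zigzag m) {..<m}"
    by (rule inj_onI) (auto simp: zigzag_def split: if_splits elim!: evenE oddE)
  show "zigzag m ` {..<m} \<subseteq> {1..m}" by (auto simp: zigzag_def)
qed auto

lemma zigzag_add_Suc:
  assumes "Suc t < m"
  shows "zigzag m t + zigzag m (Suc t) = (if even t then m + 1 else m + 2)"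
  using assms by (auto simp: zigzag_def elim!: evenE oddE)

lemma cu_labeling_three_colors:
  assumes "\<forall>x\<in>set a. 3 \<le> x" "2 \<le> length a"
  shows "\<exists>g. cu_labeling a g \<and> card (cu_sum a g ` cu_index a) \<le> 3"
proof -
  define m where "m = sum_list a"
  define g where "g p = zigzag m (tour_pos a p)" for p
  have a3: "3 \<le> a ! i" if "i < length a" for i using assms(1) that by simp
  have bij: "bij_betw g (cu_index a) {1..sum_list a}"
    using bij_betw_trans[OF bij_betw_tour_pos bij_betw_zigzag] unfolding g_def m_def comp_def .
  have inner: "cu_sum a g (i, j) = (if even (tour_pos a (i, j)) then m + 2 else m + 1)"
    if "(i, j) \<in> cu_index a" "0 < j" for i j
  proof -
    have "tour_pos a (i, j) = Suc (tour_pos a (i, j - 1))" using that by (simp add: tour_pos_def)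
    moreover have "tour_pos a (i, j) < m" using tour_pos_less_sum_list[OF that(1)]
      by (simp add: m_def)
    ultimately show ?thesis
      using that zigzag_add_Suc[of "tour_pos a (i, j - 1)" m] by (simp add: cu_sum_def g_def)
  qed
  define s where "s = (\<Sum>i<length a. g (i, 0) + g (i, a ! i - 1))"
  have center: "cu_sum a g (i, 0) = s" for i by (simp add: cu_sum_def s_def)
  have idx: "(i, 0) \<in> cu_index a" "(i, a ! i - 1) \<in> cu_index a" if "i < length a" for i
    using that a3[OF that] by (simp_all add: cu_index_def)
  \<comment> \<open>The tour passes the center between the last edge of cycle \<open>0\<close> and
    the first edge of cycle \<open>1\<close>. These consecutive labels give at least
    \<open>m + 1\<close>, and the other two end edges at least \<open>1\<close> each.\<close>
  have "m + 3 \<le> s"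
  proof -
    have len: "0 < length a" "1 < length a" using assms(2) by linarith+
    have "(\<Sum>i\<in>{0,1}. g (i, 0) + g (i, a ! i - 1)) \<le> s"
      unfolding s_def using len by (intro sum_mono2) auto
    then have *: "g (0, 0) + g (0, a ! 0 - 1) + (g (1, 0) + g (1, a ! 1 - 1)) \<le> s" by simp
    have "1 \<le> g p" if "p \<in> cu_index a" for p using bij_betwE[OF bij] that by fastforce
    then have ge: "1 \<le> g (0, 0)" "1 \<le> g (1, a ! 1 - 1)" using idx len by blast+
    have "tour_pos a (1, 0) = Suc (tour_pos a (0, a ! 0 - 1))"
      using a3[OF len(1)] len by (simp add: tour_pos_def take_Suc_conv_app_nth)
    moreover have "tour_pos a (1, 0) < m"
      using tour_pos_less_sum_list[OF idx(1)[OF len(2)]] by (simp add: m_def)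
    ultimately have "m + 1 \<le> g (0, a ! 0 - 1) + g (1, 0)"
      using zigzag_add_Suc[of "tour_pos a (0, a ! 0 - 1)" m] by (simp add: g_def)
    with ge * show ?thesis by linarith
  qed
  have "cu_sum a g (i, j) \<noteq> cu_sum a g (i, Suc j mod a ! i)" if ij: "(i, j) \<in> cu_index a" for i j
  proof -
    have less: "j < a ! i" "3 \<le> a ! i" using ij a3 by (auto simp: cu_index_def)
    consider "j = 0" | "0 < j" "Suc j = a ! i" | "0 < j" "Suc j < a ! i" using less by linarith
    then show ?thesis
    proof cases
      case 1
      have "(i, 1) \<in> cu_index a" using ij less by (simp add: cu_index_def)
      then show ?thesis using 1 less inner[of i 1] \<open>m + 3 \<le> s\<close> by (simp add: center)
    next
      case 2
      then show ?thesis using inner[OF ij] \<open>m + 3 \<le> s\<close> by (simp add: center)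
    next
      case 3
      have "(i, Suc j) \<in> cu_index a" using ij 3 by (simp add: cu_index_def)
      moreover have "tour_pos a (i, Suc j) = Suc (tour_pos a (i, j))" by (simp add: tour_pos_def)
      ultimately show ?thesis using 3 inner[OF ij] inner[of i "Suc j"] by simp
    qed
  qed
  with bij have "cu_labeling a g" by (auto simp: cu_labeling_def)
  moreover have "cu_sum a g ` cu_index a \<subseteq> {m + 1, m + 2, s}"
  proof (rule image_subsetI)
    fix p assume "p \<in> cu_index a"
    then show "cu_sum a g p \<in> {m + 1, m + 2, s}"
      using inner[of "fst p" "snd p"] center[of "fst p"] by (cases p, cases "snd p = 0") auto
  qed
  then have "card (cu_sum a g ` cu_index a) \<le> card {m + 1, m + 2, s}"
    by (intro card_mono) auto
  moreover have "card {m + 1, m + 2, s} \<le> 3" by (simp add: card_insert_if)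
  ultimately show ?thesis by (intro exI[of _ g]) simp
qed

subsection \<open>Two-colorings of the exceptional graphs\<close>

text \<open>A common template for both families: on cycle \<open>i\<close> the even positions carry
  the progression of \<open>k i\<close> terms from \<open>s i\<close> with difference
  \<open>d\<close>, the odd ones the complements to \<open>sum_list a + 1\<close>.
  \<open>surj\<close> says that all labels occur, \<open>center\<close> that the center gets
  \<open>sum_list a + 1 + d\<close>.\<close>

lemma cu_labeling_two_colors:
  fixes s k :: "nat \<Rightarrow> nat"
  assumes a: "\<And>i. i < length a \<Longrightarrow> a ! i = 2 * k i \<and> 2 \<le> k i"
    and surj: "\<And>l. l \<in> {1..sum_list a} \<Longrightarrow>
      \<exists>i<length a. \<exists>t<k i. l = s i + t * d \<or> l + (s i + t * d) = sum_list a + 1"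
    and center: "length a * (sum_list a + 1) = sum_list a + 1 + d + (\<Sum>i<length a. k i - 1) * d"
    and d: "0 < d"
  shows "\<exists>g. cu_labeling a g \<and> card (cu_sum a g ` cu_index a) \<le> 2"
proof -
  define m where "m = sum_list a"
  define g :: "nat \<times> nat \<Rightarrow> nat" where
    "g = (\<lambda>(i, j). if even j then s i + j div 2 * d else m + 1 - (s i + j div 2 * d))"
  have "{1..m} \<subseteq> g ` cu_index a"
  proof
    fix l assume l: "l \<in> {1..m}"
    then obtain i t
      where it: "i < length a" "t < k i" "l = s i + t * d \<or> l + (s i + t * d) = m + 1"
      using surj unfolding m_def by blast
    then have "l = g (i, 2 * t) \<or> l = g (i, 2 * t + 1)" by (auto simp: g_def)
    moreover have "(i, 2 * t) \<in> cu_index a" "(i, 2 * t + 1) \<in> cu_index a"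
      using it a by (auto simp: cu_index_def)
    ultimately show "l \<in> g ` cu_index a" by blast
  qed
  then have bij: "bij_betw g (cu_index a) {1..m}"
    by (intro bij_betw_if_surj) (simp_all add: finite_cu_index card_cu_index m_def)
  have even: "g (i, 2 * t) = s i + t * d" for i t by (simp add: g_def)
  \<comment> \<open>The subtraction in \<open>g\<close> does not truncate, because bijectivity has
    already made the value positive.\<close>
  have odd: "g (i, 2 * t + 1) + (s i + t * d) = m + 1" if "i < length a" "t < k i" for i t
  proof -
    have "(i, 2 * t + 1) \<in> cu_index a" using that a by (auto simp: cu_index_def)
    then have "g (i, 2 * t + 1) \<in> {1..m}" by (rule bij_betwE[OF bij, rule_format])
    then show ?thesis by (auto simp: g_def)
  qed
  \<comment> \<open>The end labels of a cycle are \<open>s i\<close> and the complement of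
    \<open>s i + (k i - 1) * d\<close>, so \<open>s i\<close> cancels.\<close>
  have "(\<Sum>i<length a. g (i, 0) + g (i, a ! i - 1)) + (\<Sum>i<length a. k i - 1) * d
      = (\<Sum>i<length a. m + 1)"
    unfolding sum_distrib_right sum.distrib[symmetric]
  proof (rule sum.cong)
    fix i assume "i \<in> {..<length a}"
    then have i: "i < length a" by simp
    then have "k i - 1 < k i" "a ! i - 1 = 2 * (k i - 1) + 1" using a[OF i] by auto
    with odd[OF i this(1)] even[of i 0] show "g (i, 0) + g (i, a ! i - 1) + (k i - 1) * d = m + 1"
      by simp
  qed simp
  then have sum0: "(\<Sum>i<length a. g (i, 0) + g (i, a ! i - 1)) = m + 1 + d"
    using center by (simp add: m_def)
  have sum: "cu_sum a g (i, j) = (if even j then m + 1 + d else m + 1)"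
    if ij: "(i, j) \<in> cu_index a" for i j
  proof (cases "j = 0")
    case True
    then show ?thesis using sum0 by (simp add: cu_sum_def)
  next
    case False
    have i: "i < length a" "j < 2 * k i" using ij a by (auto simp: cu_index_def)
    \<comment> \<open>An odd vertex lies between a term and its own complement, an even one between
      the complement of a term and the next term.\<close>
    show ?thesis
    proof (cases "even j")
      case True
      with False obtain t where j: "j = 2 * Suc t" by (metis evenE mult_0_right not0_implies_Suc)
      then have "g (i, j - 1) + (s i + t * d) = m + 1" using odd[of i t] i by simp
      moreover have "g (i, j) = s i + t * d + d" unfolding j even by simp
      ultimately show ?thesis using True False by (simp add: cu_sum_def)
    next
      case odd_j: False
      then obtain t where j: "j = 2 * t + 1" by (rule oddE)
      then show ?thesis using odd[of i t] even[of i t] i by (simp add: cu_sum_def)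
    qed
  qed
  have "cu_sum a g (i, j) \<noteq> cu_sum a g (i, Suc j mod a ! i)" if ij: "(i, j) \<in> cu_index a" for i j
  proof -
    have i: "i < length a" "j < a ! i" using ij by (auto simp: cu_index_def)
    have ij': "(i, Suc j mod a ! i) \<in> cu_index a" using i by (simp add: cu_index_def)
    have "even (Suc j mod a ! i) \<longleftrightarrow> odd j"
      using a[OF i(1)] i(2) by (metis Suc_mod_less dvd_triv_left even_Suc even_zero)
    then show ?thesis using d by (simp add: sum[OF ij] sum[OF ij'])
  qed
  with bij have "cu_labeling a g" by (auto simp: cu_labeling_def m_def)
  moreover have "card (cu_sum a g ` cu_index a) \<le> card {m + 1 + d, m + 1}"
    using sum by (intro card_mono) auto
  moreover have "card {m + 1 + d, m + 1} \<le> 2" by (simp add: card_insert_if)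
  ultimately show ?thesis by (intro exI[of _ g]) simp
qed

text \<open>Modulo \<open>d = 2 q + 1\<close>, reflection pairs the residues \<open>u\<close> and \<open>d - u\<close>; the residue class of
  \<open>0\<close> is its own mirror image and has to be cut into halves, whence the short cycle.\<close>

lemma two_colors_one_short_cycle:
  assumes "2 \<le> q"
  defines "a \<equiv> replicate q (4 * q + 2) @ [2 * q]"
  shows "\<exists>g. cu_labeling a g \<and> card (cu_sum a g ` cu_index a) \<le> 2"
proof (rule cu_labeling_two_colors)
  \<comment> \<open>Each of the first \<open>q\<close> cycles takes the full class of a residue
    \<open>1, ..., q\<close>. The last starts at \<open>d\<close>, not \<open>0\<close>, and takes
    half of the \<open>2 * q\<close> multiples of \<open>d\<close> below
    \<open>d * d\<close>.\<close>
  let ?k = "\<lambda>i. if i < q then 2 * q + 1 else q"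
  let ?s = "\<lambda>i. if i < q then i + 1 else 2 * q + 1"
  define d where "d = 2 * q + 1"
  have len: "length a = q + 1" by (simp add: a_def)
  have m: "sum_list a + 1 = d * d" by (simp add: a_def d_def sum_list_replicate algebra_simps)
  show "a ! i = 2 * ?k i \<and> 2 \<le> ?k i" if "i < length a" for i
    using that assms(1) by (auto simp: a_def nth_append)
  show "\<exists>i<length a. \<exists>t<?k i. l = ?s i + t * d \<or> l + (?s i + t * d) = sum_list a + 1"
    if l: "l \<in> {1..sum_list a}" for l
  proof -
    define u t where "u = l mod d" and "t = l div d"
    have l_eq: "l = u + t * d" by (simp add: u_def t_def)
    have u: "u < d" by (simp add: u_def d_def)
    have "l < d * d" using l m by auto
    then have t: "t < d" by (simp add: t_def less_mult_imp_div_less)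
    \<comment> \<open>In turn: the lower half of the class of \<open>0\<close>, its mirror image,
      the classes used directly, and their mirror images.\<close>
    consider "u = 0" "t \<le> q" | "u = 0" "q < t" | "1 \<le> u" "u \<le> q" | "q < u" by linarith
    then show ?thesis
    proof cases
      case 1
      then obtain w where w: "t = Suc w" using l l_eq by (cases t) auto
      then have "w < ?k q" "l = ?s q + w * d" using 1 l_eq by (auto simp: d_def)
      then show ?thesis using len by (intro exI[of _ q]) auto
    next
      case 2
      then obtain v where v: "d = t + Suc v" using t less_imp_Suc_add[of t d] by auto
      have "v < ?k q" using 2 v by (simp add: d_def)
      moreover have "l + (?s q + v * d) = t * d + (d + v * d)" using 2 l_eq by (simp add: d_def)
      moreover have "t * d + (d + v * d) = (t + Suc v) * d" by (simp add: algebra_simps)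
      ultimately show ?thesis using len m v by (intro exI[of _ q]) auto
    next
      case 3
      then have "t < ?k (u - 1)" "l = ?s (u - 1) + t * d" using l_eq t by (auto simp: d_def)
      then show ?thesis using len 3 by (intro exI[of _ "u - 1"]) auto
    next
      case 4
      obtain v where v: "d = u + Suc v" using u less_imp_Suc_add[of u d] by auto
      obtain w where w: "d = t + Suc w" using t less_imp_Suc_add[of t d] by auto
      have "v < q" using 4 v by (simp add: d_def)
      moreover have "l + (Suc v + w * d) = (t + Suc w) * d" using l_eq v
        by (simp add: algebra_simps)
      moreover have "w < 2 * q + 1" using w by (simp add: d_def)
      ultimately show ?thesis using len m w by (intro exI[of _ v]) (auto intro!: exI[of _ w])
    qed
  qed
  have "(\<Sum>i<length a. ?k i - 1) = q * (2 * q) + (q - 1)"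
    unfolding len by simp
  moreover obtain p where "q = Suc p" using assms(1) by (cases q) auto
  ultimately show "length a * (sum_list a + 1) = sum_list a + 1 + d + (\<Sum>i<length a. ?k i - 1) * d"
    unfolding m len by (simp add: d_def algebra_simps)
  show "0 < d" by (simp add: d_def)
qed

text \<open>With \<open>r = 2 h + 1\<close> and \<open>d = 2 r\<close>, reflection maps the residue \<open>u\<close> to \<open>r - u\<close> modulo \<open>d\<close>, without
  fixed points. The classes of \<open>1, \<dots>, r - 1\<close> have \<open>r\<close> elements, the others \<open>r - 1\<close>.\<close>

lemma two_colors_two_lengths:
  assumes "1 \<le> h"
  defines "a \<equiv> replicate h (4 * h + 2) @ replicate (h + 1) (4 * h)"
  shows "\<exists>g. cu_labeling a g \<and> card (cu_sum a g ` cu_index a) \<le> 2"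
proof (rule cu_labeling_two_colors)
  \<comment> \<open>The progressions start at \<open>1, ..., h\<close> and at
    \<open>2 * h + 1, ..., 3 * h + 1\<close>. The mirror classes are those of
    \<open>h + 1, ..., 2 * h\<close> and \<open>3 * h + 2, ..., 4 * h + 2\<close>.\<close>
  let ?k = "\<lambda>i. if i < h then 2 * h + 1 else 2 * h"
  let ?s = "\<lambda>i. if i < h then i + 1 else i + h + 1"
  define d where "d = 4 * h + 2"
  have len: "length a = 2 * h + 1" by (simp add: a_def)
  have m: "sum_list a = 8 * h * h + 6 * h" by (simp add: a_def sum_list_replicate algebra_simps)
  show "a ! i = 2 * ?k i \<and> 2 \<le> ?k i" if "i < length a" for i
    using that assms(1) by (auto simp: a_def nth_append simp del: replicate_Suc)
  show "\<exists>i<length a. \<exists>t<?k i. l = ?s i + t * d \<or> l + (?s i + t * d) = sum_list a + 1"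
    if l: "l \<in> {1..sum_list a}" for l
  proof -
    \<comment> \<open>The shift by one takes residues from \<open>1\<close> to \<open>d\<close>, so
      that each class begins at its own representative.\<close>
    define u t where "u = (l - 1) mod d + 1" and "t = (l - 1) div d"
    have "l - 1 = (u - 1) + t * d" by (simp add: u_def t_def)
    moreover have u: "1 \<le> u" "u \<le> d" by (auto simp: u_def d_def Suc_le_eq)
    ultimately have l_eq: "l = u + t * d" using l by auto
    have "l - 1 < (2 * h + 1) * d" using l m by (auto simp: d_def algebra_simps)
    then have t: "t \<le> 2 * h" using less_mult_imp_div_less[of "l - 1" "2 * h + 1" d]
      by (simp add: t_def)
    \<comment> \<open>Already \<open>2 * h + 1 + 2 * h * d\<close> equals
      \<open>sum_list a + 1\<close>, so these classes are one term shorter.\<close>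
    have t': "t < 2 * h" if "2 * h + 1 \<le> u"
    proof (rule ccontr)
      assume "\<not> ?thesis"
      then have "t = 2 * h" using t by simp
      then have "2 * h + 1 + 2 * h * d \<le> l" using l_eq that by simp
      then show False using l m by (simp add: d_def algebra_simps)
    qed
    consider "u \<le> h" | "h < u" "u \<le> 2 * h" | "2 * h < u" "u \<le> 3 * h + 1" | "3 * h + 1 < u" by linarith
    then show ?thesis
    proof cases
      case 1
      then have "l = ?s (u - 1) + t * d" using l_eq u by auto
      then show ?thesis using len 1 u t by (intro exI[of _ "u - 1"]) (auto intro!: exI[of _ t])
    next
      case 2
      obtain w where w: "2 * h = t + w" using t le_iff_add by blast
      obtain v where v: "2 * h = u + v" using 2 le_iff_add by blast
      have "l + (v + 1 + w * d) = u + v + 1 + (t + w) * d" using l_eq by (simp add: algebra_simps)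
      also have "\<dots> = sum_list a + 1" unfolding v[symmetric] w[symmetric] m
        by (simp add: d_def algebra_simps)
      finally show ?thesis using len 2 v w by (intro exI[of _ v]) (auto intro!: exI[of _ w])
    next
      case 3
      then have "l = ?s (u - h - 1) + t * d" using l_eq by auto
      then show ?thesis using len 3 t' by (intro exI[of _ "u - h - 1"]) (auto intro!: exI[of _ t])
    next
      case 4
      then have "Suc t \<le> 2 * h" using t' by simp
      then obtain w where w: "2 * h = Suc t + w" using le_iff_add by blast
      obtain v where v: "4 * h + 2 = u + v" using u le_iff_add unfolding d_def by blast
      have "l + (v + h + h + 1 + w * d) + d = u + v + 2 * h + 1 + (Suc t + w) * d" using l_eq
        by (simp add: algebra_simps)
      also have "\<dots> = sum_list a + 1 + d" unfolding v[symmetric] w[symmetric] m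
        by (simp add: d_def algebra_simps)
      finally have "l + (v + h + h + 1 + w * d) = sum_list a + 1" by simp
      then show ?thesis using len 4 v w by (intro exI[of _ "v + h"]) (auto intro!: exI[of _ w])
    qed
  qed
  \<comment> \<open>The number of short cycles is generalized to \<open>n\<close> for the
    induction.\<close>
  have "(\<Sum>i<n + h. ?k i - 1) = h * (2 * h) + n * (2 * h - 1)" for n
    by (induction n) simp_all
  from this[of "h + 1"] have "(\<Sum>i<length a. ?k i - 1) = h * (2 * h) + (h + 1) * (2 * h - 1)"
    by (simp add: len mult_2 add_ac)
  moreover obtain p where "h = Suc p" using assms(1) by (cases h) auto
  ultimately show "length a * (sum_list a + 1) = sum_list a + 1 + d + (\<Sum>i<length a. ?k i - 1) * d"
    unfolding m len by (simp add: d_def algebra_simps)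
  show "0 < d" by (simp add: d_def)
qed

subsection \<open>Two-colorings force the exceptional cycle lengths\<close>

lemma sum_lessThan_double:
  fixes f :: "nat \<Rightarrow> 'a::comm_monoid_add"
  shows "(\<Sum>j<2 * n. f j) = (\<Sum>t<n. f (2 * t) + f (2 * t + 1))"
  by (induction n) (simp_all add: add_ac)

text \<open>The center and one neighbor use up both colors, so the color switches at every edge;
  returning to the center forces even order.\<close>

lemma two_coloring_alternates:
  assumes a: "\<forall>x\<in>set a. 3 \<le> x" "a \<noteq> []"
    and lab: "cu_labeling a g" and two: "card (cu_sum a g ` cu_index a) \<le> 2"
  obtains x y where "\<And>i j. (i, j) \<in> cu_index a \<Longrightarrow> cu_sum a g (i, j) = (if even j then x else y)"
    and "\<And>i. i < length a \<Longrightarrow> even (a ! i)"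
proof -
  have a3: "3 \<le> a ! i" if "i < length a" for i using a(1) that by simp
  have step: "cu_sum a g (i, j) \<noteq> cu_sum a g (i, Suc j mod a ! i)"
    if "(i, j) \<in> cu_index a" for i j
    using lab that by (auto simp: cu_labeling_def)
  define x y where "x = cu_sum a g (0, 0)" and "y = cu_sum a g (0, 1)"
  have len: "0 < length a" using a(2) by simp
  have idx: "(0, 0) \<in> cu_index a" "(0, 1) \<in> cu_index a"
    using len a3[OF len] by (auto simp: cu_index_def)
  have "x \<noteq> y" using step[OF idx(1)] a3[OF len] by (simp add: x_def y_def)
  then have "2 \<le> card {x, y}" by simp
  then have "card (cu_sum a g ` cu_index a) \<le> card {x, y}" using two by linarith
  then have "{x, y} = cu_sum a g ` cu_index a"
    using idx by (intro card_seteq) (auto simp: x_def y_def finite_cu_index)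
  then have mem: "cu_sum a g p = x \<or> cu_sum a g p = y" if "p \<in> cu_index a" for p
    using that by blast
  have center: "cu_sum a g (i, 0) = x" for i by (simp add: x_def cu_sum_def)
  have alt: "cu_sum a g (i, j) = (if even j then x else y)" if "(i, j) \<in> cu_index a" for i j
    using that
  proof (induction j)
    case 0
    then show ?case by (simp add: center)
  next
    case (Suc j)
    then have ij: "(i, j) \<in> cu_index a" and "Suc j < a ! i" by (auto simp: cu_index_def)
    then show ?case using Suc.IH[OF ij] step[OF ij] mem[OF Suc.prems] by (auto split: if_splits)
  qed
  moreover have "even (a ! i)" if i: "i < length a" for i
  proof -
    have ij: "(i, a ! i - 1) \<in> cu_index a" using i a3[OF i] by (simp add: cu_index_def)
    have "Suc (a ! i - 1) = a ! i" using a3[OF i] by simp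
    then have "odd (a ! i - 1)"
      using step[OF ij] alt[OF ij] by (auto simp: center split: if_splits)
    then show ?thesis using \<open>Suc (a ! i - 1) = a ! i\<close> by (metis even_Suc)
  qed
  ultimately show ?thesis using that by blast
qed

text \<open>The alternatives come from \<open>d = 2 * r - 1\<close> and \<open>d = 2 * r\<close>.
  The order of cycle \<open>i0\<close> and the number of cycles of each order are left to be read
  off from \<open>sum_list a\<close>.\<close>

lemma two_coloring_lengths:
  assumes a: "\<forall>x\<in>set a. 3 \<le> x" and r: "r = length a" "2 \<le> r"
    and lab: "cu_labeling a g" and two: "card (cu_sum a g ` cu_index a) \<le> 2"
  shows "(\<exists>i0<r. \<forall>i<r. i \<noteq> i0 \<longrightarrow> a ! i = 4 * r - 2) \<and> sum_list a + 1 = (2 * r - 1) * (2 * r - 1) \<or>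
    (\<forall>i<r. a ! i = 2 * r \<or> a ! i = 2 * r - 2) \<and> sum_list a + r + 1 = 2 * r * r"
proof -
  have "a \<noteq> []" using r by auto
  from two_coloring_alternates[OF a this lab two] obtain x y
    where sums: "\<And>i j. (i, j) \<in> cu_index a \<Longrightarrow> cu_sum a g (i, j) = (if even j then x else y)"
      and even_a: "\<And>i. i < length a \<Longrightarrow> even (a ! i)" by blast
  define k where "k i = a ! i div 2" for i
  have ak: "a ! i = 2 * k i" "2 \<le> k i" if "i < r" for i
  proof -
    show "a ! i = 2 * k i" using even_a that r by (simp add: k_def)
    moreover have "3 \<le> a ! i" using a that r by simp
    ultimately show "2 \<le> k i" by linarith
  qed
  define m where "m = sum_list a"
  have m_eq: "m = (\<Sum>i<r. 2 * k i)"
    using ak by (simp add: m_def sum_list_sum_nth r(1) atLeast0LessThan)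
  have idx: "(i, j) \<in> cu_index a \<longleftrightarrow> i < r \<and> j < 2 * k i" for i j
    using ak r by (auto simp: cu_index_def)
  have bij: "bij_betw g (cu_index a) {1..m}" using lab by (simp add: cu_labeling_def m_def)
  have range: "1 \<le> g p" "g p \<le> m" if "p \<in> cu_index a" for p
    using bij_betwE[OF bij] that by auto
  have odd_sum: "g (i, 2 * t) + g (i, 2 * t + 1) = y" if "i < r" "t < k i" for i t
    using sums[of i "2 * t + 1"] that by (simp add: idx cu_sum_def)
  have even_sum: "g (i, 2 * t + 1) + g (i, 2 * Suc t) = x" if "i < r" "Suc t < k i" for i t
    using sums[of i "2 * Suc t"] that by (simp add: idx cu_sum_def)
  have y: "y = m + 1"
  proof -
    have "(\<Sum>p\<in>cu_index a. g p) = (\<Sum>l\<in>{1..m}. l)"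
      using sum.reindex_bij_betw[OF bij, of "\<lambda>l. l"] by simp
    moreover have "(\<Sum>p\<in>cu_index a. g p) = (\<Sum>i<r. \<Sum>j<a ! i. g (i, j))"
      by (simp add: cu_index_def r(1) sum.Sigma)
    moreover have "\<dots> = (\<Sum>i<r. k i * y)"
      by (rule sum.cong) (simp_all add: ak sum_lessThan_double odd_sum[simplified])
    moreover have "2 * (\<Sum>i<r. k i * y) = m * y"
      unfolding m_eq by (simp add: sum_distrib_left sum_distrib_right mult.assoc)
    moreover have "2 * (\<Sum>l\<in>{1..m}. l) = m * (m + 1)"
      using gauss_sum_from_Suc_0[of m, where 'a = nat] by simp
    ultimately have "m * y = m * (m + 1)" by simp
    moreover have "0 < m" using range[of "(0, 0)"] ak[of 0] r(2) by (simp add: idx)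
    ultimately show ?thesis by (metis mult_left_cancel less_irrefl)
  qed
  \<comment> \<open>An integer, since the sign of the difference is still open; \<open>d_ge\<close>
    settles it.\<close>
  define d where "d = int x - int y"
  have prog: "int (g (i, 2 * t)) = int (g (i, 0)) + int t * d" if "i < r" "t < k i" for i t
    using that(2)
  proof (induction t)
    case (Suc t)
    then show ?case using odd_sum[of i t] even_sum[of i t] that(1)
      by (simp add: d_def algebra_simps)
  qed simp
  have last: "int (g (i, 0)) + int (g (i, a ! i - 1)) + (int (k i) - 1) * d = int m + 1"
    if i: "i < r" for i
  proof -
    have "k i - 1 < k i" "a ! i - 1 = 2 * (k i - 1) + 1" "int (k i - 1) = int (k i) - 1"
      using ak[OF i] by auto
    then show ?thesis using odd_sum[OF i, of "k i - 1"] prog[OF i, of "k i - 1"] y by simp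
  qed
  have x: "x = (\<Sum>i<r. g (i, 0) + g (i, a ! i - 1))"
    using sums[of 0 0] ak(2)[of 0] r(2) by (simp add: idx cu_sum_def flip: r(1))
  \<comment> \<open>Summing \<open>last\<close> over the cycles evaluates the center; with
    \<open>x = m + 1 + d\<close> this becomes \<open>key\<close>.\<close>
  have "int x = (\<Sum>i<r. int (g (i, 0)) + int (g (i, a ! i - 1)))" by (simp add: x)
  also have "\<dots> = (\<Sum>i<r. int m + 1 - (int (k i) - 1) * d)"
    using last by (intro sum.cong) (auto simp: algebra_simps)
  also have "\<dots> = int r * (int m + 1) - ((\<Sum>i<r. int (k i)) - int r) * d"
    by (simp add: sum_subtractf sum_distrib_right[symmetric])
  finally have "int x = int r * (int m + 1) - ((\<Sum>i<r. int (k i)) - int r) * d" .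
  moreover have "int m = 2 * (\<Sum>i<r. int (k i))" by (simp add: m_eq sum_distrib_left)
  ultimately have "2 * int x = 2 * int r * (int m + 1) - (int m - 2 * int r) * d"
    by (simp add: algebra_simps)
  moreover have "int x = int m + 1 + d" by (simp add: d_def y)
  ultimately have key: "(2 * int r - 2) * (int m + 1) = d * (int m - 2 * int r + 2)"
    by (simp add: algebra_simps)
  have "(\<Sum>i<r. 4) \<le> m" unfolding m_eq using ak by (intro sum_mono) auto
  then have m_ge: "4 * int r \<le> int m" by simp
  \<comment> \<open>Otherwise the right side of \<open>key\<close> is too small, because its second
    factor is positive and less than \<open>m + 1\<close>.\<close>
  have d_ge: "2 * int r - 1 \<le> d"
  proof (rule ccontr)
    assume "\<not> ?thesis"
    then have "d * (int m - 2 * int r + 2) \<le> (2 * int r - 2) * (int m - 2 * int r + 2)"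
      using m_ge by (intro mult_right_mono) auto
    also have "\<dots> < (2 * int r - 2) * (int m + 1)"
      using r by (intro mult_strict_left_mono) auto
    finally show False using key by simp
  qed
  define X where "X = (\<lambda>i. (i, 0)) ` {..<r} \<union> (\<lambda>i. (i, a ! i - 1)) ` {..<r}"
  have X_sub: "X \<subseteq> cu_index a" using ak by (force simp: X_def idx)
  have "card X = card ((\<lambda>i. (i, 0 :: nat)) ` {..<r}) + card ((\<lambda>i. (i, a ! i - 1)) ` {..<r})"
    unfolding X_def using ak by (intro card_Un_disjoint) fastforce+
  then have card_X: "card X = 2 * r" by (simp add: card_image inj_on_def)
  have inj_X: "inj_on g X" using bij X_sub by (auto simp: bij_betw_def intro: inj_on_subset)
  \<comment> \<open>Labels grow by \<open>d\<close> along even positions and drop by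
    \<open>d\<close> along odd ones, so a label up to \<open>d\<close> can only be the first or the
    last on its cycle.\<close>
  have small: "p \<in> X" if p: "p \<in> cu_index a" "int (g p) \<le> d" for p
  proof -
    obtain i j where ij: "p = (i, j)" "i < r" "j < 2 * k i" using p(1)
      by (cases p) (auto simp: idx)
    show ?thesis
    proof (cases "even j")
      case True
      then obtain t where t: "j = 2 * t" by (rule evenE)
      have "t = 0"
      proof (rule ccontr)
        assume "t \<noteq> 0"
        then have "1 * d \<le> int t * d" using d_ge r by (intro mult_right_mono) auto
        then show False
          using prog[OF ij(2), of t] ij p range(1)[of "(i, 0)"] t by (auto simp: idx)
      qed
      then show ?thesis using ij t by (auto simp: X_def)
    next
      case False
      then obtain t where t: "j = 2 * t + 1" by (rule oddE)
      have "\<not> Suc t < k i"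
      proof
        assume *: "Suc t < k i"
        then have "(i, 2 * Suc t + 1) \<in> cu_index a" using ij by (simp add: idx)
        from range(1)[OF this] show False
          using even_sum[OF ij(2) *] odd_sum[OF ij(2) *] p ij t by (simp add: d_def)
      qed
      then have "j = a ! i - 1" using ij t ak by simp
      then show ?thesis using ij by (auto simp: X_def)
    qed
  qed
  \<comment> \<open>Ensures that all of \<open>1, ..., d\<close> are labels, for the count that
    follows.\<close>
  have "d \<le> int m"
  proof -
    have "(0, 2) \<in> cu_index a" "(0, 0) \<in> cu_index a" using ak(2)[of 0] r(2) by (auto simp: idx)
    then show ?thesis
      using prog[of 0 1] ak(2)[of 0] r(2) range(2)[of "(0, 2)"] by simp
  qed
  \<comment> \<open>The labels \<open>1, ..., d\<close> occupy \<open>d\<close> of the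
    \<open>2 * r\<close> edges in \<open>X\<close>, so at most \<open>2 * r - d\<close> edges there
    have a larger label.\<close>
  have "{1..nat d} \<subseteq> g ` {p \<in> X. int (g p) \<le> d}"
  proof
    fix l assume l: "l \<in> {1..nat d}"
    then have "l \<in> g ` cu_index a"
      using \<open>d \<le> int m\<close> bij_betw_imp_surj_on[OF bij] by auto
    then obtain p where p: "p \<in> cu_index a" "l = g p" by blast
    then have "int (g p) \<le> d" using l by auto
    then show "l \<in> g ` {p \<in> X. int (g p) \<le> d}" using p small by blast
  qed
  moreover have fin_X: "finite X" by (simp add: X_def)
  ultimately have "card {1..nat d} \<le> card {p \<in> X. int (g p) \<le> d}"
    by (intro surj_card_le) auto
  moreover have "card X = card {p \<in> X. int (g p) \<le> d} + card {p \<in> X. d < int (g p)}"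
    using fin_X by (subst card_Un_disjoint[symmetric]) (auto intro!: arg_cong[where f = card])
  ultimately have large: "int (card {p \<in> X. d < int (g p)}) + d \<le> 2 * int r"
    using card_X d_ge r by simp
  have ends: "1 \<le> g (i, 0)" "1 \<le> g (i, a ! i - 1)" "g (i, 0) \<noteq> g (i, a ! i - 1)"
    "(i, 0) \<in> X" "(i, a ! i - 1) \<in> X" if i: "i < r" for i
  proof -
    show *: "(i, 0) \<in> X" "(i, a ! i - 1) \<in> X" using i by (auto simp: X_def)
    show "g (i, 0) \<noteq> g (i, a ! i - 1)" using inj_onD[OF inj_X _ *] ak[OF i] by auto
    show "1 \<le> g (i, 0)" "1 \<le> g (i, a ! i - 1)" using range X_sub * by blast+
  qed
  have "d = 2 * int r - 1 \<or> d = 2 * int r" using d_ge large by linarith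
  then show ?thesis
  proof
    assume d: "d = 2 * int r - 1"
    have "d * d = int m + 1" using key unfolding d by (simp add: algebra_simps)
    have "card {p \<in> X. d < int (g p)} \<le> Suc 0" using large d by simp
    then have le1: "p = q" if "p \<in> X" "d < int (g p)" "q \<in> X" "d < int (g q)" for p q
      using that fin_X card_le_Suc0_iff_eq[of "{p \<in> X. d < int (g p)}"]
      by (simp del: split_paired_All)
    \<comment> \<open>The cycle of the only edge in \<open>X\<close> whose label may exceed
      \<open>d\<close>; if there is none, cycle \<open>0\<close> serves as a default.\<close>
    obtain i0 where i0: "i0 < r" "\<And>p. p \<in> X \<Longrightarrow> d < int (g p) \<Longrightarrow> fst p = i0"
    proof (cases "\<exists>p\<in>X. d < int (g p)")
      case True
      then obtain p where p: "p \<in> X" "d < int (g p)" by blast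
      have "fst p < r" using p(1) by (auto simp: X_def)
      moreover have "fst q = fst p" if "q \<in> X" "d < int (g q)" for q
        using le1[OF that p] by simp
      ultimately show ?thesis by (rule that)
    next
      case False
      then show ?thesis using that[of 0] r(2) by auto
    qed
    have "a ! i = 4 * r - 2" if i: "i < r" "i \<noteq> i0" for i
    proof -
      note e = ends[OF i(1)]
      have "int (g (i, 0)) \<le> d" "int (g (i, a ! i - 1)) \<le> d"
        using i0(2)[OF e(4)] i0(2)[OF e(5)] i(2) by (simp_all add: not_less[symmetric]) blast+
      then have e': "0 < int (g (i, 0)) + int (g (i, a ! i - 1))"
        "int (g (i, 0)) + int (g (i, a ! i - 1)) < d * 2" using e(1-3) by linarith+
      \<comment> \<open>The end labels sum to a multiple of \<open>d\<close> strictly between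
        \<open>0\<close> and \<open>2 * d\<close>, hence to \<open>d\<close>, which gives
        \<open>k i = d\<close>.\<close>
      have "int (g (i, 0)) + int (g (i, a ! i - 1)) = d * (d - (int (k i) - 1))"
        using last[OF i(1)] \<open>d * d = int m + 1\<close> by (simp add: algebra_simps)
      then have "0 < d * (d - (int (k i) - 1))" "d * (d - (int (k i) - 1)) < d * 2" using e'
        by simp_all
      then have "0 < d - (int (k i) - 1)" "d - (int (k i) - 1) < 2"
        using d_ge r(2) by (simp_all add: zero_less_mult_iff)
      then have "int (k i) = d" by linarith
      then show ?thesis using ak(1)[OF i(1)] d by linarith
    qed
    moreover have "m + 1 = (2 * r - 1) * (2 * r - 1)"
    proof -
      have "int (m + 1) = int (2 * r - 1) * int (2 * r - 1)"
        using \<open>d * d = int m + 1\<close> d r(2) by (simp add: of_nat_diff)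
      then show ?thesis by (simp only: of_nat_eq_iff flip: of_nat_mult)
    qed
    ultimately show ?thesis using i0(1) unfolding m_def by blast
  next
    assume d: "d = 2 * int r"
    have m: "int m + int r + 1 = 2 * int r * int r" using key unfolding d
      by (simp add: algebra_simps)
    have "card {p \<in> X. d < int (g p)} = 0" using large d by simp
    then have "{p \<in> X. d < int (g p)} = {}" using fin_X by simp
    then have le: "int (g p) \<le> d" if "p \<in> X" for p using that not_less by blast
    have "a ! i = 2 * r \<or> a ! i = 2 * r - 2" if i: "i < r" for i
    proof -
      note e = ends[OF i]
      have e': "0 < int (g (i, 0)) + int (g (i, a ! i - 1))"
        "int (g (i, 0)) + int (g (i, a ! i - 1)) < 4 * int r"
        using le[OF e(4)] le[OF e(5)] e(1-3) d by linarith+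
      \<comment> \<open>This is a positive multiple of \<open>2 * r\<close> below
        \<open>5 * r\<close>, so it is \<open>2 * r\<close> or \<open>4 * r\<close>, giving
        \<open>k i = r\<close> or \<open>k i = r - 1\<close>.\<close>
      have "int (g (i, 0)) + int (g (i, a ! i - 1)) + int r = 2 * int r * (int r - (int (k i) - 1))"
        using last[OF i] m d by (simp add: algebra_simps)
      then have "int r * 0 < int r * (int r - (int (k i) - 1))"
        "int r * (2 * (int r - (int (k i) - 1))) < int r * 5"
        using e' r(2) by (simp_all add: algebra_simps)
      then have "0 < int r - (int (k i) - 1)" "2 * (int r - (int (k i) - 1)) < 5"
        using r(2) by (simp_all add: mult_less_cancel_left zero_less_mult_iff)
      then have "int (k i) = int r \<or> int (k i) = int r - 1" by arith
      then show ?thesis using ak(1)[OF i] by arith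
    qed
    moreover have "int (m + r + 1) = int (2 * r * r)" using m by simp
    then have "m + r + 1 = 2 * r * r" by (simp only: of_nat_eq_iff)
    ultimately show ?thesis unfolding m_def by blast
  qed
qed

subsection \<open>The chromatic number\<close>

text \<open>Adjacent vertices force two colors and the zigzag labeling needs at most three, so only
  the existence of a two-coloring matters.\<close>

lemma chi_la_cycle_union:
  assumes "\<forall>x\<in>set a. 3 \<le> x" "2 \<le> length a"
  shows "chi_la (cycle_union a) =
    (if \<exists>g. cu_labeling a g \<and> card (cu_sum a g ` cu_index a) \<le> 2 then 2 else 3)"
proof -
  let ?n = "\<lambda>g. card (cu_sum a g ` cu_index a)"
  have ge2: "2 \<le> ?n g" if "cu_labeling a g" for g
  proof -
    have a0: "0 < length a" using assms(2) by linarith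
    then have idx: "(0, 0) \<in> cu_index a" "(0, 1) \<in> cu_index a" and "3 \<le> a ! 0"
      using bspec[OF assms(1) nth_mem[OF a0]] by (auto simp: cu_index_def)
    then have "cu_sum a g (0, 0) \<noteq> cu_sum a g (0, 1)"
      using that by (force simp: cu_labeling_def)
    then have "2 \<le> card {cu_sum a g (0, 0), cu_sum a g (0, 1)}" by simp
    also have "\<dots> \<le> ?n g" using idx by (intro card_mono) (auto simp: finite_cu_index)
    finally show ?thesis .
  qed
  have le: "chi_la (cycle_union a) \<le> enat (?n g)" if "cu_labeling a g" for g
  proof -
    from cu_labeling_realize[OF assms(1) that] obtain f
      where "local_antimagic_labeling (cycle_union a) f" "color_number (cycle_union a) f = ?n g" by blast
    then show ?thesis unfolding chi_la_def by (intro INF_lower2[of f]) auto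
  qed
  obtain g3 where g3: "cu_labeling a g3" "?n g3 \<le> 3"
    using cu_labeling_three_colors[OF assms] by blast
  then obtain f3 where "local_antimagic_labeling (cycle_union a) f3"
    using cu_labeling_realize[OF assms(1)] by blast
  \<comment> \<open>As some labeling exists, the infimum in \<open>enat\<close> is attained.\<close>
  then have "chi_la (cycle_union a) \<in> (\<lambda>f. enat (color_number (cycle_union a) f)) `
      {f. local_antimagic_labeling (cycle_union a) f}"
    unfolding chi_la_def by (intro wellorder_InfI) blast
  then obtain f where f: "local_antimagic_labeling (cycle_union a) f"
    "chi_la (cycle_union a) = enat (color_number (cycle_union a) f)" by blast
  define g where "g p = f (cu_edge a p)" for p
  have g: "cu_labeling a g" "chi_la (cycle_union a) = enat (?n g)"
    using f unfolding g_def local_antimagic_labeling_cycle_union_iff[OF assms(1)]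
      color_number_cycle_union[OF assms(1)] by simp_all
  show ?thesis
  proof (cases "\<exists>g. cu_labeling a g \<and> ?n g \<le> 2")
    case True
    then obtain g' where "cu_labeling a g'" "?n g' \<le> 2" by blast
    then have "?n g = 2" using le[of g'] ge2[OF g(1)] g(2) by simp
    then show ?thesis using True g(2) by (simp add: numeral_eq_enat)
  next
    case False
    then have "\<not> ?n g \<le> 2" using g(1) by blast
    moreover have "?n g \<le> 3" using le[OF g3(1)] g3(2) g(2) by simp
    ultimately have "?n g = 3" by linarith
    then show ?thesis using False g(2) by (simp add: numeral_eq_enat)
  qed
qed

lemma sorted_two_values:
  fixes a :: "'a::linorder list"
  assumes "sorted_wrt (\<ge>) a" "set a \<subseteq> {x, y}" "y < x"
  shows "\<exists>p q. a = replicate p x @ replicate q y"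
  using assms
proof (induction a)
  case (Cons z a)
  then obtain p q where a: "a = replicate p x @ replicate q y" by auto
  show ?case
  proof (cases "z = x")
    case True
    then have "z # a = replicate (Suc p) x @ replicate q y" using a by simp
    then show ?thesis by blast
  next
    case False
    then have z: "z = y" using Cons.prems by auto
    have "x \<notin> set a" using Cons.prems z by auto
    then have "z # a = replicate 0 x @ replicate (Suc q) y" using a z by (cases p) auto
    then show ?thesis by blast
  qed
qed simp

text \<open>The value of \<open>sum_list a\<close> fixes the remaining orders and multiplicities,
  and sortedness fixes their places.\<close>

lemma two_coloring_list:
  assumes r: "r = length a" "2 \<le> r" and sorted: "sorted_wrt (\<ge>) a" and a3: "\<forall>x\<in>set a. 3 \<le> x"
    and "cu_labeling a g" "card (cu_sum a g ` cu_index a) \<le> 2"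
  shows "3 \<le> r \<and> a = replicate (r - 1) (4 * r - 2) @ [2 * r - 2] \<or>
    odd r \<and> a = replicate ((r - 1) div 2) (2 * r) @ replicate ((r + 1) div 2) (2 * r - 2)"
  using two_coloring_lengths[OF a3 r assms(5,6)]
proof (elim disjE conjE exE)
  fix i0
  assume i0: "i0 < r" "\<forall>i<r. i \<noteq> i0 \<longrightarrow> a ! i = 4 * r - 2"
    and sum: "sum_list a + 1 = (2 * r - 1) * (2 * r - 1)"
  obtain q where q: "r = Suc q" "1 \<le> q" using r(2) by (cases r) auto
  have "sum_list a = (\<Sum>i<r. a ! i)" by (simp add: sum_list_sum_nth r(1) atLeast0LessThan)
  also have "\<dots> = a ! i0 + (\<Sum>i\<in>{..<r} - {i0}. a ! i)"
    using i0(1) by (subst sum.remove[of _ i0]) auto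
  also have "(\<Sum>i\<in>{..<r} - {i0}. a ! i) = (\<Sum>i\<in>{..<r} - {i0}. 4 * r - 2)"
    using i0(2) by (intro sum.cong) auto
  also have "\<dots> = q * (4 * q + 2)" using i0(1) q by simp
  finally have ai0: "a ! i0 = 2 * q" using sum q by (simp add: algebra_simps)
  \<comment> \<open>The odd cycle out is shorter than the others, so it stands last.\<close>
  have "i0 = q"
  proof (rule ccontr)
    assume "i0 \<noteq> q"
    then have "i0 < q" using i0(1) q by simp
    then have "a ! q \<le> a ! i0" using sorted r q by (simp add: sorted_wrt_iff_nth_less)
    moreover have "a ! q = 4 * r - 2" using i0(2) \<open>i0 \<noteq> q\<close> q by simp
    ultimately show False using ai0 q by simp
  qed
  have "a = replicate q (4 * r - 2) @ [2 * q]"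
  proof (rule nth_equalityI)
    fix i assume "i < length a"
    then have "i < q \<or> i = q" using r(1) q by linarith
    then show "a ! i = (replicate q (4 * r - 2) @ [2 * q]) ! i"
      using i0(2) ai0 \<open>i0 = q\<close> q(1) by (auto simp: nth_append)
  qed (use r q in simp)
  \<comment> \<open>This excludes \<open>r = 2\<close>, where the short cycle would have order
    \<open>2\<close>.\<close>
  moreover have "3 \<le> 2 * q" using bspec[OF a3 nth_mem[of i0 a]] ai0 i0(1) r(1) by simp
  ultimately show ?thesis using q by simp
next
  assume vals: "\<forall>i<r. a ! i = 2 * r \<or> a ! i = 2 * r - 2" and sum: "sum_list a + r + 1 = 2 * r * r"
  have "set a \<subseteq> {2 * r, 2 * r - 2}" using vals r(1) by (auto simp: in_set_conv_nth)
  then obtain p q where a: "a = replicate p (2 * r) @ replicate q (2 * r - 2)"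
    using sorted_two_values[OF sorted, of "2 * r" "2 * r - 2"] r(2) by auto
  have pq: "r = p + q" using arg_cong[OF a, of length] by (simp flip: r(1))
  have "int (sum_list a) = int p * (2 * int r) + int q * (2 * int r - 2)"
    unfolding a using r(2) by (simp add: sum_list_replicate of_nat_diff)
  also have "\<dots> = 2 * int r * int r - 2 * int q" using pq by (simp add: algebra_simps)
  finally have "2 * int q = int r + 1" using arg_cong[OF sum, of int] by simp
  then have "r = 2 * p + 1" "q = p + 1" using pq by linarith+
  then show ?thesis using a by simp
qed

theorem theorem2p4:
  fixes r :: nat and a :: "nat list" and G :: "'v ugraph"
  assumes "r \<ge> 2" and "length a = r"
    and "sorted_wrt (\<ge>) a" and "\<forall>x\<in>set a. x \<ge> 3"
    and "simple_graph G" and "G \<simeq>\<^sub>g cycle_union a"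
  defines "exceptional \<equiv>
      (r \<ge> 3 \<and> G \<simeq>\<^sub>g cycle_union (replicate (r - 1) (4 * r - 2) @ [2 * r - 2])) \<or>
      (odd r \<and> G \<simeq>\<^sub>g cycle_union
         (replicate ((r - 1) div 2) (2 * r) @ replicate ((r + 1) div 2) (2 * r - 2)))"
  shows "(chi_la G = 2 \<longleftrightarrow> exceptional) \<and> (\<not> exceptional \<longrightarrow> chi_la G = 3)"
proof -
  \<comment> \<open>Stated for every list \<open>b\<close> that describes \<open>G\<close>:
    \<open>exceptional\<close> provides only an isomorphism, and its list need not be compared with
    \<open>a\<close>.\<close>
  have chi_la_G: "chi_la G =
      (if \<exists>g. cu_labeling b g \<and> card (cu_sum b g ` cu_index b) \<le> 2 then 2 else 3)"
    if "G \<simeq>\<^sub>g cycle_union b" "\<forall>x\<in>set b. x \<ge> 3" "2 \<le> length b" for b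
    using chi_la_iso[OF assms(5) simple_graph_cycle_union that(1)] chi_la_cycle_union that by simp
  have two: "chi_la G = 2" if exceptional
    using that unfolding exceptional_def
  proof (elim disjE conjE)
    assume r: "3 \<le> r" and G: "G \<simeq>\<^sub>g cycle_union (replicate (r - 1) (4 * r - 2) @ [2 * r - 2])"
    define q where "q = r - 1"
    then have "2 \<le> q" "r = Suc q" using r by simp_all
    with G have "G \<simeq>\<^sub>g cycle_union (replicate q (4 * q + 2) @ [2 * q])" by simp
    then show ?thesis
      using chi_la_G two_colors_one_short_cycle[OF \<open>2 \<le> q\<close>] \<open>2 \<le> q\<close> by simp
  next
    assume "odd r" and G: "G \<simeq>\<^sub>g cycle_union
         (replicate ((r - 1) div 2) (2 * r) @ replicate ((r + 1) div 2) (2 * r - 2))"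
    then obtain h where h: "r = 2 * h + 1" by (auto elim: oddE)
    then have "1 \<le> h" using assms(1) by simp
    have "G \<simeq>\<^sub>g cycle_union (replicate h (4 * h + 2) @ replicate (h + 1) (4 * h))"
      using G h by simp
    then show ?thesis
      using chi_la_G two_colors_two_lengths[OF \<open>1 \<le> h\<close>] \<open>1 \<le> h\<close> by simp
  qed
  have "chi_la G = 3" if "\<not> exceptional"
  proof -
    have "\<not> (\<exists>g. cu_labeling a g \<and> card (cu_sum a g ` cu_index a) \<le> 2)"
    proof
      assume "\<exists>g. cu_labeling a g \<and> card (cu_sum a g ` cu_index a) \<le> 2"
      then obtain g where "cu_labeling a g" "card (cu_sum a g ` cu_index a) \<le> 2" by blast
      from two_coloring_list[OF assms(2)[symmetric] assms(1,3,4) this] have exceptional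
        unfolding exceptional_def using assms(6) by (elim disjE conjE) simp_all
      with that show False ..
    qed
    then show ?thesis using chi_la_G[OF assms(6,4)] assms(1,2) by simp
  qed
  with two show ?thesis by (cases exceptional) simp_all
qed

end
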